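(* Let $k\ge 3$. Let $\vec{\mathbf b}=\{\vec b(m)\}_{m=1}^\infty$, $\vec b(m)=(b_1(m),\dots,b_k(m))$, be a sequence of vectors of integers with $b_1(m),\dots,b_{k-2}(m)>0$ and $b_{k-1}(m),b_k(m)\ge 0$ for every $m$. Then for every $m\ge 6$, writing $b_i=b_i(m)$ and $\alpha=\alpha(\vec{\mathbf b})(m)$, $$\left(\frac{1}{2\left(\alpha+\frac1m\right)\binom{b_{k-1}+b_k}{b_k}}\right)^{\frac1k}\le f\bigl(m,H(\vec b(m))\bigr)\le\frac{k(k-1)}{\alpha}+k-1 .$$
   Context: A hypergraph is a finite set of distinct finite sets (its edges); $|F|$ denotes the number of edges of $F$, and a subgraph of $F$ is a subset of its edges. A copy of $H$ in $F$ is a set of edges of $F$ which, as a hypergraph, is isomorphic to $H$. $F$ is $H$-free if it contains no copy of $H$. Let $\mathrm{ex}(F,H)$ be the maximum number of edges of an $H$-free subgraph of $F$, and $f(m,H):=\min_{|F|=m}\mathrm{ex}(F,H)$, the minimum being over all hypergraphs $F$ with $m$ edges (not necessarily uniform). For a vector $\vec b=(b_1,\dots,b_k)$ of nonnegative integers with $b_1,\dots,b_{k-1}$ not all zero, $H(\vec b)$ is the (unique up to isomorphism) $k$-edge hypergraph $\{A_1,\dots,A_k\}$ such that for every $1\le\ell\le k$ and every $I\in\binom{[k]}{\ell}$, $$\left|\bigcap_{i\in I}A_i\setminus\bigcup_{i\in[k]\setminus I}A_i\right|=b_\ell .$$ For a sequence $\vec{\mathbf b}=\{\vec b(m)\}_{m\ge1}$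 of such vectors, $$\alpha(\vec{\mathbf b})(m):=\min_{1\le i\le k-2}\frac{b_i(m)}{m\,b_{i+1}(m)} .$$ Convention: a fraction with positive numerator and zero denominator (possible only for $i=k-2$, when $b_{k-1}(m)=0$) is $+\infty$; if $\alpha=+\infty$ then $k(k-1)/\alpha$ and the left-hand side of the inequality are both read as $0$. *)

theory Defs
  imports Complex_Main "HOL-Library.Extended_Real" "HOL-Library.Nat_Bijection"
begin

text \<open>A hypergraph is given by its set of edges; its vertices are the elements of its edges.\<close>

definition hypergraph :: "'a set set \<Rightarrow> bool" where
  "hypergraph F \<longleftrightarrow> finite F \<and> (\<forall>e\<in>F. finite e)"

definition hg_iso :: "'a set set \<Rightarrow> 'b set set \<Rightarrow> bool" where
  "hg_iso E E' \<longleftrightarrow> (\<exists>\<phi>. bij_betw \<phi> (\<Union>E) (\<Union>E') \<and> (\<lambda>e. \<phi> ` e) ` E = E')"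

definition is_copy_in :: "'b set set \<Rightarrow> 'b set set \<Rightarrow> 'a set set \<Rightarrow> bool" where
  "is_copy_in C F H \<longleftrightarrow> C \<subseteq> F \<and> hg_iso H C"

definition hg_free :: "'a set set \<Rightarrow> 'b set set \<Rightarrow> bool" where
  "hg_free H F \<longleftrightarrow> \<not> (\<exists>C. is_copy_in C F H)"

text \<open>For nonempty \<open>H\<close> the set below is nonempty, since the edgeless subgraph is \<open>H\<close>-free.\<close>

definition ex_num :: "'b set set \<Rightarrow> 'a set set \<Rightarrow> nat" where
  "ex_num F H = Max {card G | G. G \<subseteq> F \<and> hg_free H G}"

text \<open>Every hypergraph is isomorphic to one with vertices in \<open>nat\<close>, so the minimum may be
  taken over those. On \<open>nat\<close>, \<open>Inf\<close> of a nonempty set is its minimum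
  (see \<open>f_num_attained\<close> below).\<close>

definition f_num :: "nat \<Rightarrow> 'a set set \<Rightarrow> nat" where
  "f_num m H = Inf {ex_num F H | F :: nat set set. hypergraph F \<and> card F = m}"

text \<open>A vector \<open>(b\<^sub>1, \<dots>, b\<^sub>k)\<close> is a function on \<open>nat\<close> of which only the values at \<open>1, \<dots>, k\<close> matter.
  Injectivity of \<open>A\<close> says that the hypergraph has exactly \<open>k\<close> edges.\<close>

definition is_Hvec :: "nat \<Rightarrow> (nat \<Rightarrow> nat) \<Rightarrow> 'a set set \<Rightarrow> bool" where
  "is_Hvec k b E \<longleftrightarrow>
     (\<exists>A. inj_on A {1..k} \<and> E = A ` {1..k} \<and> (\<forall>i\<in>{1..k}. finite (A i)) \<and>
          (\<forall>l\<in>{1..k}. \<forall>I. I \<subseteq> {1..k} \<and> card I = l \<longrightarrow>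
             card ((\<Inter>i\<in>I. A i) - (\<Union>i\<in>{1..k} - I. A i)) = b l))"

text \<open>Existence and uniqueness up to isomorphism are \<open>is_Hvec_Hvec\<close> and \<open>is_Hvec_unique\<close> below.\<close>

definition Hvec :: "nat \<Rightarrow> (nat \<Rightarrow> nat) \<Rightarrow> nat set set" where
  "Hvec k b = (SOME E. is_Hvec k b E)"

text \<open>In \<^typ>\<open>ereal\<close>, a positive number divided by \<open>0\<close> is \<open>\<infinity>\<close>, and a real divided by \<open>\<infinity>\<close> is \<open>0\<close>.\<close>

definition alpha :: "nat \<Rightarrow> (nat \<Rightarrow> nat \<Rightarrow> nat) \<Rightarrow> nat \<Rightarrow> ereal" where
  "alpha k b m =
     Min ((\<lambda>i. ereal (real (b m i)) / ereal (real m * real (b m (i + 1)))) ` {1..k - 2})"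


lemma f_num_attained:
  "\<exists>F :: nat set set. hypergraph F \<and> card F = m \<and> ex_num F H = f_num m H"
proof -
  have "hypergraph ((\<lambda>x::nat. {x}) ` {..<m})" "card ((\<lambda>x::nat. {x}) ` {..<m}) = m"
    by (auto simp: hypergraph_def card_image)
  then have "{ex_num F H | F :: nat set set. hypergraph F \<and> card F = m} \<noteq> {}"
    by blast
  from Inf_nat_def1[OF this] show ?thesis
    unfolding f_num_def by (smt (verit) mem_Collect_eq)
qed

lemma is_Hvec_exists:
  assumes "l0 \<in> {1..k - 1}" "b l0 > 0"
  shows "\<exists>E :: nat set set. is_Hvec k b E"
proof -
  define A where "A i = {prod_encode (set_encode I, j) | I j. I \<subseteq> {1..k} \<and> i \<in> I \<and> j < b (card I)}"
    for i
  have mem: "prod_encode (set_encode I, j) \<in> A i \<longleftrightarrow> i \<in> I \<and> j < b (card I)"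
    if I: "I \<subseteq> {1..k}" for I i j
  proof
    assume "prod_encode (set_encode I, j) \<in> A i"
    then obtain I' j' where *: "prod_encode (set_encode I, j) = prod_encode (set_encode I', j')"
      "I' \<subseteq> {1..k}" "i \<in> I'" "j' < b (card I')" unfolding A_def by blast
    have "finite I" "finite I'" using I *(2) finite_subset by blast+
    moreover have "set_encode I = set_encode I'" "j = j'" using *(1) by (simp_all add: prod_encode_eq)
    ultimately have "I = I'" by (simp add: set_encode_eq)
    then show "i \<in> I \<and> j < b (card I)" using * \<open>j = j'\<close> by simp
  next
    assume "i \<in> I \<and> j < b (card I)"
    then show "prod_encode (set_encode I, j) \<in> A i" unfolding A_def using I by blast
  qed
  have elt: "\<exists>I j. x = prod_encode (set_encode I, j) \<and> I \<subseteq> {1..k}" if "x \<in> A i" for x i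
    using that unfolding A_def by blast
  have fin: "finite (A i)" for i
  proof (rule finite_subset)
    show "A i \<subseteq> (\<lambda>(I, j). prod_encode (set_encode I, j)) ` (SIGMA I:Pow {1..k}. {..<b (card I)})"
      unfolding A_def by (force simp: image_iff)
  qed auto
  have atom: "(\<Inter>i\<in>I. A i) - (\<Union>i\<in>{1..k} - I. A i) = (\<lambda>j. prod_encode (set_encode I, j)) ` {..<b (card I)}"
    if I: "I \<subseteq> {1..k}" "I \<noteq> {}" for I
  proof (intro equalityI subsetI)
    fix x assume x: "x \<in> (\<Inter>i\<in>I. A i) - (\<Union>i\<in>{1..k} - I. A i)"
    obtain i0 where i0: "i0 \<in> I" using I by blast
    then have "x \<in> A i0" using x by blast
    then obtain J j where J: "x = prod_encode (set_encode J, j)" "J \<subseteq> {1..k}" using elt by blast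
    have memx: "x \<in> A i \<longleftrightarrow> i \<in> J \<and> j < b (card J)" for i using mem[OF J(2)] J(1) by simp
    then have jb: "j < b (card J)" using \<open>x \<in> A i0\<close> by simp
    have "i \<in> J" if "i \<in> I" for i
    proof -
      have "x \<in> A i" using x that by blast
      then show ?thesis using memx by simp
    qed
    moreover have "i \<in> I" if "i \<in> J" for i
    proof (rule ccontr)
      assume "i \<notin> I"
      moreover have "x \<in> A i" using that memx jb by simp
      ultimately show False using x that J(2) by blast
    qed
    ultimately have "I = J" by blast
    then show "x \<in> (\<lambda>j. prod_encode (set_encode I, j)) ` {..<b (card I)}" using J jb by blast
  next
    fix x assume "x \<in> (\<lambda>j. prod_encode (set_encode I, j)) ` {..<b (card I)}"
    then show "x \<in> (\<Inter>i\<in>I. A i) - (\<Union>i\<in>{1..k} - I. A i)" using mem[OF I(1)] by auto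
  qed
  have "inj_on A {1..k}"
  proof (rule inj_onI, rule ccontr)
    fix i i' assume i: "i \<in> {1..k}" "i' \<in> {1..k}" "A i = A i'" "i \<noteq> i'"
    have "card ({1..k} - {i, i'}) = k - 2" using i by (simp add: card_Diff_subset)
    moreover have "l0 - 1 \<le> k - 2" using assms(1) by auto
    ultimately obtain T where T: "T \<subseteq> {1..k} - {i, i'}" "card T = l0 - 1" "finite T"
      by (metis obtain_subset_with_card_n)
    have c: "card (insert i T) = l0" using T assms(1) by (subst card_insert_disjoint) auto
    have s: "insert i T \<subseteq> {1..k}" using T i by auto
    have "prod_encode (set_encode (insert i T), 0) \<in> A i"
      using mem[OF s] c assms(2) by auto
    then have "prod_encode (set_encode (insert i T), 0) \<in> A i'" using i by simp
    then show False using mem[OF s] T i by auto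
  qed
  moreover have "card ((\<Inter>i\<in>I. A i) - (\<Union>i\<in>{1..k} - I. A i)) = b l"
    if "l \<in> {1..k}" "I \<subseteq> {1..k}" "card I = l" for I l
  proof -
    have "I \<noteq> {}" using that by auto
    then show ?thesis
      using atom[OF that(2)] that by (simp add: card_image inj_on_def prod_encode_eq)
  qed
  ultimately have "is_Hvec k b (A ` {1..k})"
    unfolding is_Hvec_def using fin by blast
  then show ?thesis by blast
qed

lemma is_Hvec_Hvec:
  assumes "l0 \<in> {1..k - 1}" "b l0 > 0"
  shows "is_Hvec k b (Hvec k b)"
  unfolding Hvec_def using is_Hvec_exists[of l0 k b, OF assms] by (rule someI_ex)

lemma is_Hvec_unique:
  assumes "is_Hvec k b E" "is_Hvec k b E'"
  shows "hg_iso E E'"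
proof -
  obtain A where A: "E = A ` {1..k}" "\<forall>i\<in>{1..k}. finite (A i)"
    "\<forall>l\<in>{1..k}. \<forall>I. I \<subseteq> {1..k} \<and> card I = l \<longrightarrow>
       card ((\<Inter>i\<in>I. A i) - (\<Union>i\<in>{1..k} - I. A i)) = b l"
    using assms(1) unfolding is_Hvec_def by blast
  obtain B where B: "E' = B ` {1..k}" "\<forall>i\<in>{1..k}. finite (B i)"
    "\<forall>l\<in>{1..k}. \<forall>I. I \<subseteq> {1..k} \<and> card I = l \<longrightarrow>
       card ((\<Inter>i\<in>I. B i) - (\<Union>i\<in>{1..k} - I. B i)) = b l"
    using assms(2) unfolding is_Hvec_def by blast
  define tA where "tA I = (\<Inter>i\<in>I. A i) - (\<Union>i\<in>{1..k} - I. A i)" for I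
  define tB where "tB I = (\<Inter>i\<in>I. B i) - (\<Union>i\<in>{1..k} - I. B i)" for I
  have "\<exists>g. bij_betw g (tA I) (tB I)" if I: "I \<subseteq> {1..k}" "I \<noteq> {}" for I
  proof -
    have l: "card I \<in> {1..k}"
      using I card_mono[OF finite_atLeastAtMost I(1)] card_gt_0_iff[of I]
        finite_subset[OF I(1) finite_atLeastAtMost] by auto
    obtain i where i: "i \<in> I" "i \<in> {1..k}" using I by blast
    have "tA I \<subseteq> A i" "tB I \<subseteq> B i" using i by (auto simp: tA_def tB_def)
    then have "finite (tA I)" "finite (tB I)" using A(2) B(2) i finite_subset by blast+
    moreover have "card (tA I) = card (tB I)" using A(3) B(3) l I by (simp add: tA_def tB_def)
    ultimately show ?thesis by (rule finite_same_card_bij)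
  qed
  then obtain g where g: "\<And>I. I \<subseteq> {1..k} \<Longrightarrow> I \<noteq> {} \<Longrightarrow> bij_betw (g I) (tA I) (tB I)"
    by metis
  define J where "J v = {i\<in>{1..k}. v \<in> A i}" for v
  define \<phi> where "\<phi> v = g (J v) v" for v
  have key: "\<phi> v \<in> tB (J v)" "v \<in> tA (J v)" "J v \<noteq> {}" "J v \<subseteq> {1..k}" if "v \<in> \<Union>E" for v
  proof -
    show J: "J v \<noteq> {}" "J v \<subseteq> {1..k}" using that A(1) by (auto simp: J_def)
    show v: "v \<in> tA (J v)" using that by (auto simp: tA_def J_def)
    show "\<phi> v \<in> tB (J v)" using g[OF J(2,1)] v unfolding \<phi>_def bij_betw_def by blast
  qed
  have mem: "\<phi> v \<in> B i \<longleftrightarrow> v \<in> A i" if "v \<in> \<Union>E" "i \<in> {1..k}" for v i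
    using key[OF that(1)] that(2) by (auto simp: tB_def J_def)
  have surj: "\<exists>v\<in>\<Union>E. \<phi> v = w" if w: "w \<in> \<Union>E'" for w
  proof -
    define K where "K = {i\<in>{1..k}. w \<in> B i}"
    have K: "K \<subseteq> {1..k}" "K \<noteq> {}" "w \<in> tB K" using w B(1) by (auto simp: K_def tB_def)
    then have "w \<in> g K ` tA K" using g[OF K(1,2)] by (simp add: bij_betw_def)
    then obtain v where v: "v \<in> tA K" "g K v = w" by auto
    have "J v = K" using v(1) K by (auto simp: tA_def J_def)
    moreover have "v \<in> \<Union>E" using v(1) K A(1) by (auto simp: tA_def)
    ultimately show ?thesis using v unfolding \<phi>_def by auto
  qed
  have inj: "inj_on \<phi> (\<Union>E)"
  proof (rule inj_onI)
    fix v v' assume v: "v \<in> \<Union>E" "v' \<in> \<Union>E" "\<phi> v = \<phi> v'"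
    have "J v = J v'" using mem[OF v(1)] mem[OF v(2)] v(3) by (auto simp: J_def)
    then show "v = v'"
      using key[OF v(1)] key[OF v(2)] g[of "J v"] v(3)
      unfolding \<phi>_def bij_betw_def inj_on_def by auto
  qed
  have img: "\<phi> ` A i = B i" if i: "i \<in> {1..k}" for i
  proof (intro equalityI subsetI)
    fix w assume "w \<in> \<phi> ` A i"
    then obtain v where v: "v \<in> A i" "w = \<phi> v" by blast
    have "v \<in> \<Union>E" using v i A(1) by blast
    then show "w \<in> B i" using mem[of v i] i v by simp
  next
    fix w assume w: "w \<in> B i"
    then obtain v where "v \<in> \<Union>E" "\<phi> v = w" using surj i B(1) by blast
    then have "v \<in> A i" using mem[of v i] i w by simp
    then show "w \<in> \<phi> ` A i" using \<open>\<phi> v = w\<close> by blast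
  qed
  have "(\<lambda>e. \<phi> ` e) ` E = E'" using img A(1) B(1) by (simp add: image_image)
  moreover have "\<phi> ` (\<Union>E) = \<Union>E'" using calculation by blast
  ultimately show ?thesis unfolding hg_iso_def bij_betw_def using inj by blast
qed

end

theory Submission
  imports Defs
begin

text \<open>
  Throughout, \<open>H = H(b)\<close>, and \<open>e\<close> is the largest size of an \<open>H\<close>-free subgraph of a hypergraph
  \<open>F\<close> with \<open>m\<close> edges. A cell of a family of sets is the set of the points that lie in all members
  of a given nonempty subfamily and in no other member; \<open>H\<close> is determined by its cell sizes.

  \<^bold>\<open>Lower bound.\<close> If \<open>S\<close> has more than \<open>b\<^sub>k\<close> points, then the edges of \<open>F\<close> that contain \<open>S\<close> are
  \<open>H\<close>-free, because the edges of a copy of \<open>H\<close> share only \<open>b\<^sub>k\<close> points; so there are at most \<open>e\<close> of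
  them. Fix \<open>k - 1\<close> edges and count the edges \<open>A\<close> that complete them to a copy of \<open>H\<close>. The fixed
  edges share \<open>b\<^bsub>k-1\<^esub> + b\<^sub>k\<close> points, and \<open>A\<close> contains exactly \<open>b\<^sub>k\<close> of these, so there are
  \<open>(b\<^bsub>k-1\<^esub> + b\<^sub>k) choose b\<^sub>k\<close> possibilities for the trace \<open>S\<close> of \<open>A\<close>. Moreover a cell of \<open>i \<le> k - 2\<close>
  of the fixed edges has \<open>b\<^sub>i + b\<^bsub>i+1\<^esub>\<close> points, of which \<open>A\<close> contains \<open>b\<^bsub>i+1\<^esub>\<close>. For a given trace \<open>S\<close>,
  each point \<open>v\<close> of the cell lies in at most \<open>e\<close> of the edges \<open>A\<close>, since they all contain
  \<open>S \<union> {v}\<close>. Double counting thus allows at most \<open>e (b\<^sub>i + b\<^bsub>i+1\<^esub>) / b\<^bsub>i+1\<^esub>\<close> edges \<open>A\<close> per trace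
  (\<open>card_extensions_le\<close>). Now take a maximal \<open>H\<close>-free subgraph \<open>G\<close>. Every other edge of \<open>F\<close>
  completes some \<open>k - 1\<close> edges of \<open>G\<close> to a copy of \<open>H\<close>, so \<open>m - e\<close> is at most \<open>e\<^bsup>k-1\<^esup>\<close> times the
  number of completions. This gives the \<open>k\<close>-th power in the bound (\<open>card_le_ex_num_power\<close>), when
  \<open>i\<close> is an index that attains the minimum \<open>\<alpha>\<close>.

  \<^bold>\<open>Upper bound.\<close> Put \<open>n = \<lfloor>\<alpha> m\<rfloor>\<close>, or \<open>n = m\<close> if \<open>\<alpha> = \<infinity>\<close>, so that \<open>n b\<^bsub>i+1\<^esub> \<le> b\<^sub>i\<close> for all
  \<open>i \<le> k - 2\<close>. Then there are \<open>k + n\<close> sets any \<open>k\<close> of which form a copy of \<open>H\<close>. Indeed, let every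
  subset of size \<open>j\<close> of the \<open>k + n\<close> indices have a cell with \<open>w j\<close> points. A cell of \<open>k\<close> of these
  sets is the union of the \<open>2\<^sup>n\<close> cells obtained by deciding membership in the other \<open>n\<close> sets, so
  \<open>w\<close> must satisfy \<open>\<Sum>j. (n choose j) w (l + j) = b\<^sub>l\<close>. For \<open>l = k\<close>, put all \<open>b\<^sub>k\<close> points into
  the intersection of all \<open>k + n\<close> sets. For \<open>l < k\<close>, the equation is solved by inverting \<open>n\<close> times
  the operator \<open>c \<mapsto> (\<lambda>l. c l + c (l + 1))\<close>; the solution is nonnegative because it is at least
  \<open>b\<^sub>l - n b\<^bsub>l+1\<^esub>\<close> (\<open>unshift_ge\<close>). Taking disjoint copies of this family, the last one truncated,
  until there are \<open>m\<close> edges, an \<open>H\<close>-free subgraph has at most \<open>k - 1\<close> edges in each of the roughly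
  \<open>1 / \<alpha>\<close> blocks (\<open>ex_num_blocks\<close>).
\<close>

section \<open>Hypergraphs with prescribed cells\<close>

text \<open>Cells indexed by subfamilies rather than by index sets: no enumeration of the edges has to
  be chosen, and edges can be added to a family without renumbering it.\<close>

lemma is_Hvec_iff_cells:
  "is_Hvec k b E \<longleftrightarrow> finite E \<and> card E = k \<and> (\<forall>e\<in>E. finite e) \<and>
     (\<forall>D\<subseteq>E. D \<noteq> {} \<longrightarrow> card (\<Inter>D - \<Union>(E - D)) = b (card D))"
    (is "?L \<longleftrightarrow> ?R")
proof
  assume ?L
  then obtain A where A: "inj_on A {1..k}" "E = A ` {1..k}" "\<forall>i\<in>{1..k}. finite (A i)"
    "\<And>l I. l \<in> {1..k} \<Longrightarrow> I \<subseteq> {1..k} \<Longrightarrow> card I = l \<Longrightarrow>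
       card ((\<Inter>i\<in>I. A i) - (\<Union>i\<in>{1..k} - I. A i)) = b l"
    unfolding is_Hvec_def by metis
  have "card (\<Inter>D - \<Union>(E - D)) = b (card D)" if D: "D \<subseteq> E" "D \<noteq> {}" for D
  proof -
    define I where "I = {i\<in>{1..k}. A i \<in> D}"
    have I: "I \<subseteq> {1..k}" "A ` I = D" "A ` ({1..k} - I) = E - D"
      using D A(2) unfolding I_def by auto
    have cI: "card I = card D" using card_image[OF inj_on_subset[OF A(1) I(1)]] I(2) by simp
    have "finite I" "I \<noteq> {}" using I D finite_subset[OF I(1)] by auto
    then have "card I \<in> {1..k}"
      using card_mono[OF _ I(1)] by (simp add: card_gt_0_iff Suc_le_eq)
    from A(4)[OF this I(1) refl] show ?thesis using I cI by simp
  qed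
  then show ?R using A card_image[OF A(1)] by auto
next
  assume R: ?R
  then obtain A where "bij_betw A {1..k} E" using ex_bij_betw_nat_finite_1[of E] by auto
  then have A: "inj_on A {1..k}" "A ` {1..k} = E" by (auto simp: bij_betw_def)
  have "card ((\<Inter>i\<in>I. A i) - (\<Union>i\<in>{1..k} - I. A i)) = b l"
    if I: "l \<in> {1..k}" "I \<subseteq> {1..k}" "card I = l" for l I
  proof -
    have "A ` ({1..k} - I) = E - A ` I" using A I(2) by (auto dest: inj_onD)
    moreover have "A ` I \<subseteq> E" "A ` I \<noteq> {}" using A I by auto
    moreover have "card (A ` I) = l" using card_image[OF inj_on_subset[OF A(1) I(2)]] I(3) by simp
    ultimately show ?thesis using R by metis
  qed
  then show ?L unfolding is_Hvec_def using A R by (intro exI[of _ A]) auto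
qed

lemma is_Hvec_hg_iso:
  assumes "is_Hvec k b E" "hg_iso E E'"
  shows "is_Hvec k b E'"
proof -
  obtain A where A: "inj_on A {1..k}" "E = A ` {1..k}" "\<forall>i\<in>{1..k}. finite (A i)"
    "\<forall>l\<in>{1..k}. \<forall>I. I \<subseteq> {1..k} \<and> card I = l \<longrightarrow>
       card ((\<Inter>i\<in>I. A i) - (\<Union>i\<in>{1..k} - I. A i)) = b l"
    using assms(1) unfolding is_Hvec_def by blast
  obtain \<phi> where "bij_betw \<phi> (\<Union>E) (\<Union>E')" and E': "(\<lambda>e. \<phi> ` e) ` E = E'"
    using assms(2) unfolding hg_iso_def by blast
  then have inj: "inj_on \<phi> (\<Union>E)" by (simp add: bij_betw_def)
  have sub: "A i \<subseteq> \<Union>E" if "i \<in> {1..k}" for i using that A(2) by blast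
  define B where "B i = \<phi> ` A i" for i
  have "inj_on B {1..k}"
  proof (rule inj_onI)
    fix i j assume ij: "i \<in> {1..k}" "j \<in> {1..k}" "B i = B j"
    then have "A i = A j" using inj_on_image_eq_iff[OF inj sub sub] by (simp add: B_def)
    then show "i = j" using inj_onD[OF A(1)] ij by blast
  qed
  moreover have "E' = B ` {1..k}" using E' A(2) by (simp add: B_def image_image)
  moreover have "\<forall>i\<in>{1..k}. finite (B i)" using A(3) by (simp add: B_def)
  moreover have "card ((\<Inter>i\<in>I. B i) - (\<Union>i\<in>{1..k} - I. B i)) = b l"
    if I: "l \<in> {1..k}" "I \<subseteq> {1..k}" "card I = l" for l I
  proof -
    obtain j where j: "j \<in> I" using I by fastforce
    let ?X = "\<Inter>i\<in>I. A i" and ?Y = "\<Union>i\<in>{1..k} - I. A i"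
    have X: "?X \<subseteq> \<Union>E" using j I(2) sub by blast
    have Y: "?Y \<subseteq> \<Union>E" using sub by blast
    have "(\<Inter>i\<in>I. B i) = \<phi> ` ?X"
      unfolding B_def using image_INT[OF inj _ j, of A] sub I(2) by blast
    moreover have "(\<Union>i\<in>{1..k} - I. B i) = \<phi> ` ?Y" unfolding B_def by blast
    ultimately have "(\<Inter>i\<in>I. B i) - (\<Union>i\<in>{1..k} - I. B i) = \<phi> ` (?X - ?Y)"
      using inj_on_image_set_diff[OF inj Diff_subset[THEN subset_trans, OF X] Y] by simp
    moreover have "card (\<phi> ` (?X - ?Y)) = card (?X - ?Y)"
      using X by (intro card_image inj_on_subset[OF inj]) auto
    ultimately show ?thesis using A(4) I by simp
  qed
  ultimately show ?thesis unfolding is_Hvec_def by (intro exI[of _ B]) auto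
qed

text \<open>The cell sizes determine the isomorphism type and are invariant under isomorphism, so
  copies of \<open>H(b)\<close> can be recognised by their cells alone.\<close>

lemma hg_free_Hvec_iff:
  assumes "is_Hvec k b (Hvec k b)"
  shows "hg_free (Hvec k b) G \<longleftrightarrow> (\<forall>C\<subseteq>G. \<not> is_Hvec k b C)"
  unfolding hg_free_def is_copy_in_def
  using is_Hvec_unique[OF assms] is_Hvec_hg_iso[OF assms] by blast

lemma card_le_ex_num:
  assumes "finite F" "G \<subseteq> F" "hg_free H G"
  shows "card G \<le> ex_num F H"
proof -
  have "{card G | G. G \<subseteq> F \<and> hg_free H G} \<subseteq> card ` Pow F" by blast
  then have "finite {card G | G. G \<subseteq> F \<and> hg_free H G}"
    using assms(1) by (meson finite_Pow_iff finite_imageI finite_subset)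
  then show ?thesis unfolding ex_num_def using assms by (intro Max_ge) auto
qed

lemma ex_num_le:
  fixes F :: "'b set set"
  assumes "finite F" "hg_free H ({} :: 'b set set)" "\<And>G. G \<subseteq> F \<Longrightarrow> hg_free H G \<Longrightarrow> card G \<le> N"
  shows "ex_num F H \<le> N"
proof -
  have "{card G | G. G \<subseteq> F \<and> hg_free H G} \<subseteq> card ` Pow F" by blast
  then have "finite {card G | G. G \<subseteq> F \<and> hg_free H G}"
    using assms(1) by (meson finite_Pow_iff finite_imageI finite_subset)
  moreover have "card ({} :: 'b set set) \<in> {card G | G. G \<subseteq> F \<and> hg_free H G}"
    using assms(2) by (intro CollectI exI[of _ "{}"]) simp
  ultimately show ?thesis unfolding ex_num_def using assms(3) by (intro Max.boundedI) auto
qed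

lemma f_num_le_ex_num:
  fixes F :: "nat set set"
  assumes "hypergraph F" "card F = m"
  shows "f_num m H \<le> ex_num F H"
  unfolding f_num_def using assms by (intro cInf_lower) auto

section \<open>The lower bound\<close>

lemma Hvec_free_if_common_superset:
  assumes "finite S" "card S > b k" "k \<ge> 1" "\<And>A. A \<in> G \<Longrightarrow> S \<subseteq> A" "C \<subseteq> G"
  shows "\<not> is_Hvec k b C"
proof
  assume "is_Hvec k b C"
  then have C: "finite C" "card C = k" "\<forall>e\<in>C. finite e"
    and cells: "\<And>D. D \<subseteq> C \<Longrightarrow> D \<noteq> {} \<Longrightarrow> card (\<Inter>D - \<Union>(C - D)) = b (card D)"
    unfolding is_Hvec_iff_cells by auto
  have ne: "C \<noteq> {}" using C assms(3) by auto
  then have "card (\<Inter>C) = b k" using cells[of C] C by simp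
  moreover have "S \<subseteq> \<Inter>C" using assms(4,5) by blast
  moreover have "finite (\<Inter>C)" using C ne by (meson Inter_lower ex_in_conv finite_subset)
  ultimately show False using assms(2) card_mono by (metis not_less)
qed

text \<open>The completions \<open>A\<close> of \<open>K\<close> are sorted by their trace \<open>S\<close> on \<open>P = \<Inter>K\<close>. Within one class, the
  pairs of a completion \<open>A\<close> and a point of \<open>V \<inter> A\<close> are counted in two ways, where \<open>V\<close> is the cell of an
  \<open>i\<close>-element subfamily \<open>D\<close> of \<open>K\<close>. Since \<open>i \<le> k - 2\<close>, \<open>D\<close> is not all of \<open>K\<close>, so that \<open>V\<close> avoids
  \<open>P\<close>, and a point of \<open>V\<close> together with \<open>S\<close> is a set of \<open>b k + 1\<close> points common to the
  completions that contain the point.\<close>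

lemma card_extensions_le:
  fixes F :: "'a set set"
  assumes fin: "finite F" and i: "i \<in> {1..k - 2}" and K: "finite K" "card K = k - 1"
    and e: "\<And>G. G \<subseteq> F \<Longrightarrow> (\<forall>C\<subseteq>G. \<not> is_Hvec k b C) \<Longrightarrow> card G \<le> e"
  shows "b (i + 1) * card {A \<in> F - K. is_Hvec k b (insert A K)}
           \<le> (b i + b (i + 1)) * e * ((b (k - 1) + b k) choose b k)"
proof -
  define X where "X = {A \<in> F - K. is_Hvec k b (insert A K)}"
  have finX: "finite X" unfolding X_def by (rule finite_subset[OF _ fin]) blast
  have "i \<le> card K" using K i by auto
  then obtain D where D: "D \<subseteq> K" "card D = i"
    by (rule obtain_subset_with_card_n)
  have Dne: "D \<noteq> {}" "D \<noteq> K" using D K i by auto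
  have Kne: "K \<noteq> {}" using Dne D by blast
  (* A completion splits each cell of K into two cells of the copy of H. *)
  have split_cell: "card (\<Inter>L - \<Union>(K - L) - A) = b (card L)
      \<and> card ((\<Inter>L - \<Union>(K - L)) \<inter> A) = b (card L + 1) \<and> finite (\<Inter>L)"
    if A: "A \<in> X" and L: "L \<subseteq> K" "L \<noteq> {}" for A L
  proof -
    have AK: "A \<notin> K" and H: "is_Hvec k b (insert A K)" using A by (auto simp: X_def)
    then have cells: "\<And>D. D \<subseteq> insert A K \<Longrightarrow> D \<noteq> {} \<Longrightarrow>
        card (\<Inter>D - \<Union>(insert A K - D)) = b (card D)"
      and fins: "\<forall>e\<in>insert A K. finite e"
      unfolding is_Hvec_iff_cells by auto
    have "finite L" using L K finite_subset by blast
    have "\<Inter>L - \<Union>(insert A K - L) = \<Inter>L - \<Union>(K - L) - A" using AK L by blast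
    moreover have "\<Inter>(insert A L) - \<Union>(insert A K - insert A L) = (\<Inter>L - \<Union>(K - L)) \<inter> A"
      using AK by blast
    moreover have "card (insert A L) = card L + 1" using AK L \<open>finite L\<close> by (subst card_insert_disjoint) auto
    moreover have "finite (\<Inter>L)" using fins L by (meson Inter_lower ex_in_conv finite_subset insertCI subsetD)
    ultimately show ?thesis
      using cells[OF subset_insertI2[OF L(1)] L(2)] cells[OF insert_mono[OF L(1)] insert_not_empty]
      by simp
  qed
  show ?thesis
  proof (cases "X = {}")
    case True
    then show ?thesis by (simp only: X_def[symmetric]) simp
  next
    case False
    then obtain A0 where A0: "A0 \<in> X" by blast
    define V where "V = \<Inter>D - \<Union>(K - D)"
    define P where "P = \<Inter>K"
    have k: "k \<ge> 3" using i by auto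
    have kk: "k - 1 + 1 = k" using k by simp
    have VA: "card (V \<inter> A) = b (i + 1)" "card (V - A) = b i" if "A \<in> X" for A
      using split_cell[OF that D(1) Dne(1)] D(2) by (auto simp: V_def)
    have PA: "card (P \<inter> A) = b k" "card (P - A) = b (k - 1)" if "A \<in> X" for A
      using split_cell[OF that subset_refl Kne] K(2) kk by (auto simp: P_def)
    have finV: "finite V" and finP: "finite P"
      using split_cell[OF A0 D(1) Dne(1)] split_cell[OF A0 subset_refl Kne]
      by (auto simp: V_def P_def)
    have cV: "card V = b i + b (i + 1)"
      using VA[OF A0] finV card_Int_Diff[of V A0] by simp
    have cP: "card P = b (k - 1) + b k"
      using PA[OF A0] finP card_Int_Diff[of P A0] by simp
    have VP: "V \<inter> P = {}" using D Dne by (auto simp: V_def P_def)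
    define Q where "Q = {S. S \<subseteq> P \<and> card S = b k}"
    have finQ: "finite Q"
      unfolding Q_def by (rule finite_subset[of _ "Pow P"]) (use finP in auto)
    have cQ: "card Q = (b (k - 1) + b k) choose b k"
      using n_subsets[OF finP, of "b k"] cP by (simp add: Q_def)
    have class_le: "b (i + 1) * card {A\<in>X. P \<inter> A = S} \<le> (b i + b (i + 1)) * e" if S: "S \<in> Q" for S
    proof -
      let ?Y = "{A\<in>X. P \<inter> A = S}"
      have finY: "finite ?Y" by (rule finite_subset[OF _ finX]) blast
      have deg: "card {A\<in>?Y. v \<in> A} \<le> e" if v: "v \<in> V" for v
      proof (rule e)
        show "{A\<in>?Y. v \<in> A} \<subseteq> F" by (auto simp: X_def)
        have "v \<notin> S" using v VP S by (auto simp: Q_def)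
        moreover have "finite S" "card S = b k" using S finP finite_subset by (auto simp: Q_def)
        ultimately have "finite (insert v S)" "card (insert v S) > b k" by auto
        then show "\<forall>C\<subseteq>{A\<in>?Y. v \<in> A}. \<not> is_Hvec k b C"
          using k by (intro allI impI Hvec_free_if_common_superset[of "insert v S"]) auto
      qed
      have "b (i + 1) * card ?Y = (\<Sum>A\<in>?Y. card (V \<inter> A))" using VA by simp
      also have "\<dots> = (\<Sum>A\<in>?Y. \<Sum>v\<in>V. if v \<in> A then 1 else 0)"
        using finV by (simp add: sum.If_cases Int_def)
      also have "\<dots> = (\<Sum>v\<in>V. \<Sum>A\<in>?Y. if v \<in> A then 1 else 0)" by (rule sum.swap)
      also have "\<dots> = (\<Sum>v\<in>V. card {A\<in>?Y. v \<in> A})"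
        using finY by (simp add: sum.If_cases Int_def)
      also have "\<dots> \<le> (\<Sum>v\<in>V. e)" by (intro sum_mono deg)
      also have "\<dots> = (b i + b (i + 1)) * e" using cV by simp
      finally show ?thesis .
    qed
    have "X = (\<Union>S\<in>Q. {A\<in>X. P \<inter> A = S})" using PA by (auto simp: Q_def)
    then have "card X \<le> (\<Sum>S\<in>Q. card {A\<in>X. P \<inter> A = S})"
      using card_UN_le[OF finQ, of "\<lambda>S. {A\<in>X. P \<inter> A = S}"] by simp
    then have "b (i + 1) * card X \<le> (\<Sum>S\<in>Q. b (i + 1) * card {A\<in>X. P \<inter> A = S})"
      by (simp add: sum_distrib_left[symmetric])
    also have "\<dots> \<le> (\<Sum>S\<in>Q. (b i + b (i + 1)) * e)" by (intro sum_mono class_le)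
    also have "\<dots> = (b i + b (i + 1)) * e * ((b (k - 1) + b k) choose b k)" using cQ by simp
    finally show ?thesis by (simp only: X_def)
  qed
qed

text \<open>Either a maximal \<open>H\<close>-free subgraph misses at least half of \<open>F\<close>, and each missed edge
  completes \<open>k - 1\<close> of its edges, or \<open>ex_num\<close> is already linear in \<open>card F\<close>.\<close>

lemma card_le_ex_num_power:
  fixes F :: "'a set set"
  assumes fin: "finite F" and i: "i \<in> {1..k - 2}" and H: "is_Hvec k b (Hvec k b)"
  shows "card F * b (i + 1)
    \<le> 2 * (b i + b (i + 1)) * ((b (k - 1) + b k) choose b k) * ex_num F (Hvec k b) ^ k"
proof -
  define e where "e = ex_num F (Hvec k b)"
  define c where "c = (b (k - 1) + b k) choose b k"
  define free where "free G \<longleftrightarrow> (\<forall>C\<subseteq>G. \<not> is_Hvec k b C)" for G :: "'a set set"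
  have k: "k \<ge> 3" using i by auto
  have c1: "c \<ge> 1" by (simp add: c_def Suc_le_eq)
  have le_e: "card G \<le> e" if "G \<subseteq> F" "free G" for G
    using card_le_ex_num[OF fin that(1), of "Hvec k b"] that(2)
    by (simp add: e_def free_def hg_free_Hvec_iff[OF H])
  show ?thesis
  proof (cases "card F \<le> 2 * e")
    case True
    have "e \<le> e ^ k" using k by (cases "e = 0") (auto intro: self_le_power)
    then have F: "card F \<le> 2 * e ^ k" using True by linarith
    have "b (i + 1) \<le> (b i + b (i + 1)) * c"
      using mult_le_mono[OF _ c1, of "b (i + 1)" "b i + b (i + 1)"] by simp
    from mult_le_mono[OF F this] show ?thesis
      unfolding e_def[symmetric] c_def[symmetric] by (simp add: algebra_simps)
  next
    case False
    have empty_free: "free {}" using k by (simp add: free_def is_Hvec_iff_cells)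
    define \<G> where "\<G> = {G. G \<subseteq> F \<and> free G}"
    have "finite \<G>" unfolding \<G>_def by (rule finite_subset[of _ "Pow F"]) (use fin in auto)
    moreover have "{} \<in> \<G>" using empty_free by (simp add: \<G>_def)
    ultimately obtain G where G_mem: "G \<in> \<G>" and G_max: "\<forall>G'\<in>\<G>. G \<subseteq> G' \<longrightarrow> G = G'"
      using finite_has_maximal2[of \<G> "{}"] by blast
    have G: "G \<subseteq> F" "free G" using G_mem by (simp_all add: \<G>_def)
    have finG: "finite G" using G fin finite_subset by blast
    have Ge: "card G \<le> e" using le_e G by blast
    define KK where "KK = {K. K \<subseteq> G \<and> card K = k - 1}"
    let ?X = "\<lambda>K. {A \<in> F - K. is_Hvec k b (insert A K)}"
    have finKK: "finite KK"
      unfolding KK_def by (rule finite_subset[of _ "Pow G"]) (use finG in auto)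
    have cKK: "card KK = card G choose (k - 1)"
      using n_subsets[OF finG, of "k - 1"] by (simp add: KK_def)
    have "F - G \<subseteq> (\<Union>K\<in>KK. ?X K)"
    proof
      fix A assume A: "A \<in> F - G"
      have "insert A G \<notin> \<G>" using G_max A by blast
      then have "\<not> free (insert A G)" using A G(1) by (simp add: \<G>_def)
      then obtain C where C: "C \<subseteq> insert A G" "is_Hvec k b C" by (auto simp: free_def)
      have "A \<in> C" using C G(2) by (auto simp: free_def)
      have "finite C" "card C = k" using C(2) by (auto simp: is_Hvec_iff_cells)
      then have "C - {A} \<in> KK" using C \<open>A \<in> C\<close> by (auto simp: KK_def)
      moreover have "A \<in> ?X (C - {A})" using A C \<open>A \<in> C\<close> by (simp add: insert_absorb)
      ultimately show "A \<in> (\<Union>K\<in>KK. ?X K)" by blast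
    qed
    moreover have "finite (\<Union>K\<in>KK. ?X K)" using finKK fin by simp
    ultimately have "card (F - G) \<le> card (\<Union>K\<in>KK. ?X K)" by (intro card_mono)
    also have "\<dots> \<le> (\<Sum>K\<in>KK. card (?X K))" by (rule card_UN_le[OF finKK])
    finally have "b (i + 1) * card (F - G) \<le> (\<Sum>K\<in>KK. b (i + 1) * card (?X K))"
      by (simp add: sum_distrib_left[symmetric])
    also have "\<dots> \<le> (\<Sum>K\<in>KK. (b i + b (i + 1)) * e * c)"
    proof (rule sum_mono)
      fix K assume "K \<in> KK"
      then have "finite K" "card K = k - 1" using finG finite_subset by (auto simp: KK_def)
      then show "b (i + 1) * card (?X K) \<le> (b i + b (i + 1)) * e * c"
        unfolding c_def by (intro card_extensions_le[OF fin i]) (use le_e in \<open>auto simp: free_def\<close>)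
    qed
    also have "\<dots> = (card G choose (k - 1)) * ((b i + b (i + 1)) * e * c)" by (simp add: cKK)
    also have "\<dots> \<le> e ^ (k - 1) * ((b i + b (i + 1)) * e * c)"
    proof (rule mult_le_mono1)
      have "card G choose (k - 1) \<le> card G ^ (k - 1)"
        by (cases "k - 1 \<le> card G") (auto intro: binomial_le_pow simp: not_le binomial_eq_0)
      also have "\<dots> \<le> e ^ (k - 1)" using Ge by (rule power_mono) simp
      finally show "card G choose (k - 1) \<le> e ^ (k - 1)" .
    qed
    also have "\<dots> = (b i + b (i + 1)) * c * e ^ k"
      using k by (cases k) (auto simp: mult_ac)
    finally have *: "b (i + 1) * card (F - G) \<le> (b i + b (i + 1)) * c * e ^ k" .
    have "card F \<le> 2 * card (F - G)"
      using card_Diff_subset[OF finG G(1)] Ge False by simp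
    then have "card F * b (i + 1) \<le> 2 * (b (i + 1) * card (F - G))"
      using mult_le_mono1[of "card F" "2 * card (F - G)" "b (i + 1)"] by (simp add: mult_ac)
    also have "\<dots> \<le> 2 * ((b i + b (i + 1)) * c * e ^ k)" using * by simp
    finally show ?thesis unfolding e_def[symmetric] c_def[symmetric] by (simp only: mult.assoc)
  qed
qed

section \<open>The upper bound\<close>

text \<open>For \<open>a\<close> supported below \<open>k\<close>, the sequence \<open>unshift k a n\<close> arises from \<open>a\<close> by solving \<open>n\<close>
  times the equation \<open>c' l + c' (l + 1) = c l\<close>, from \<open>l = k - 1\<close> downwards. Subtraction is
  truncated; \<open>unshift_Suc_add\<close> gives the condition under which nothing is lost.\<close>

function unshift :: "nat \<Rightarrow> (nat \<Rightarrow> nat) \<Rightarrow> nat \<Rightarrow> nat \<Rightarrow> nat" where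
  "unshift k a 0 l = a l"
| "unshift k a (Suc n) l = (if l < k then unshift k a n l - unshift k a (Suc n) (l + 1) else 0)"
  by pat_completeness auto
termination
  by (relation "measures [\<lambda>(k, a, n, l). n, \<lambda>(k, a, n, l). k - l]") auto

(* Its right-hand side contains another instance of its left-hand side, so it would be
   unfolded forever. *)
declare unshift.simps(2) [simp del]

lemma unshift_Suc_less:
  "l < k \<Longrightarrow> unshift k a (Suc n) l = unshift k a n l - unshift k a (Suc n) (l + 1)"
  by (subst unshift.simps(2)) simp

lemma unshift_Suc_ge: "k \<le> l \<Longrightarrow> unshift k a (Suc n) l = 0"
  by (subst unshift.simps(2)) simp

lemma unshift_le: "unshift k a n l \<le> a l"
proof (induction n)
  case (Suc n)
  then show ?case
    by (cases "l < k") (simp_all add: unshift_Suc_less unshift_Suc_ge del: add_Suc_right)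
qed simp

lemma unshift_ge:
  assumes "\<And>l. l \<ge> k \<Longrightarrow> a l = 0"
  shows "a l - n * a (l + 1) \<le> unshift k a n l"
proof (induction n)
  case (Suc n)
  have "a l - Suc n * a (l + 1) = a l - n * a (l + 1) - a (l + 1)" by simp
  also have "\<dots> \<le> unshift k a n l - a (l + 1)" by (rule diff_le_mono[OF Suc])
  also have "\<dots> \<le> unshift k a n l - unshift k a (Suc n) (l + 1)"
    by (rule diff_le_mono2[OF unshift_le])
  finally have le: "a l - Suc n * a (l + 1) \<le> unshift k a n l - unshift k a (Suc n) (l + 1)" .
  show ?case
  proof (cases "l < k")
    case True
    then show ?thesis using le by (simp only: unshift_Suc_less)
  next
    case False
    then show ?thesis using assms[of l] by simp
  qed
qed simp

lemma unshift_Suc_add: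
  assumes "\<And>l. l \<ge> k \<Longrightarrow> a l = 0" "Suc n * a (l + 1) \<le> a l"
  shows "unshift k a (Suc n) l + unshift k a (Suc n) (l + 1) = unshift k a n l"
proof (cases "l < k")
  case True
  have "unshift k a (Suc n) (l + 1) \<le> a (l + 1)" by (rule unshift_le)
  also have "\<dots> \<le> a l - n * a (l + 1)" using assms(2) by simp
  also have "\<dots> \<le> unshift k a n l" by (rule unshift_ge[OF assms(1)])
  finally show ?thesis using True by (simp add: unshift_Suc_less)
next
  case False
  then show ?thesis using unshift_le[of k a n l] assms(1)[of l] by (simp add: unshift_Suc_ge)
qed

text \<open>By Pascal's rule: the subsets of \<open>insert x N\<close> come in pairs \<open>J\<close>, \<open>insert x J\<close>, and the two
  terms of a pair add up to the term of \<open>J\<close> for one step less.\<close>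

lemma sum_unshift_Pow:
  assumes "finite N" "l \<ge> 1" "\<And>l. l \<ge> k \<Longrightarrow> a l = 0"
    and "\<And>l. l \<ge> 1 \<Longrightarrow> card N * a (l + 1) \<le> a l"
  shows "(\<Sum>J\<in>Pow N. unshift k a (card N) (l + card J)) = a l"
  using assms(1,2,4)
proof (induction N rule: finite_induct)
  case (insert x N)
  let ?n = "card N"
  have cn: "card (insert x N) = Suc ?n" using insert by simp
  have hyp: "Suc ?n * a (l + 1) \<le> a l" if "l \<ge> 1" for l using insert.prems(2)[OF that] cn by metis
  have hyp': "?n * a (l + 1) \<le> a l" if "l \<ge> 1" for l using hyp[OF that] by simp
  have inj: "inj_on (insert x) (Pow N)" using insert(2) by (intro inj_onI) (metis PowD insert_ident subsetD)
  have disj: "Pow N \<inter> insert x ` Pow N = {}" using insert(2) by blast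
  have "(\<Sum>J\<in>Pow (insert x N). unshift k a (Suc ?n) (l + card J))
      = (\<Sum>J\<in>Pow N. unshift k a (Suc ?n) (l + card J))
        + (\<Sum>J\<in>Pow N. unshift k a (Suc ?n) (l + card (insert x J)))"
    unfolding Pow_insert using insert(1) disj inj
    by (subst sum.union_disjoint) (auto simp: sum.reindex)
  also have "(\<Sum>J\<in>Pow N. unshift k a (Suc ?n) (l + card (insert x J)))
      = (\<Sum>J\<in>Pow N. unshift k a (Suc ?n) (l + card J + 1))"
  proof (rule sum.cong)
    fix J assume "J \<in> Pow N"
    then have "card (insert x J) = Suc (card J)"
      using insert(1,2) finite_subset by (intro card_insert_disjoint) auto
    then show "unshift k a (Suc ?n) (l + card (insert x J)) = unshift k a (Suc ?n) (l + card J + 1)"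
      by simp
  qed simp
  also have "(\<Sum>J\<in>Pow N. unshift k a (Suc ?n) (l + card J))
        + (\<Sum>J\<in>Pow N. unshift k a (Suc ?n) (l + card J + 1))
      = (\<Sum>J\<in>Pow N. unshift k a ?n (l + card J))"
    unfolding sum.distrib[symmetric]
  proof (rule sum.cong)
    fix J
    have "Suc ?n * a (l + card J + 1) \<le> a (l + card J)" using insert.prems(1) by (intro hyp) simp
    with assms(3) show "unshift k a (Suc ?n) (l + card J) + unshift k a (Suc ?n) (l + card J + 1)
        = unshift k a ?n (l + card J)"
      by (rule unshift_Suc_add)
  qed simp
  also have "\<dots> = a l" by (rule insert.IH[OF insert.prems(1) hyp'])
  finally show ?case using cn by simp
qed simp

text \<open>The \<open>q\<close>-th block consists of the numbers with quotient \<open>q\<close> on division by \<open>s = k + n\<close>. A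
  vertex is a pair \<open>(J, j)\<close>, encoded as a number, with \<open>J\<close> a subset of a block and \<open>j < w (card J)\<close>,
  and the edge \<open>E x\<close> consists of the vertices with \<open>x \<in> J\<close>. As \<open>J\<close> is nonempty, it determines its
  block, and edges from different blocks are disjoint.\<close>

lemma ex_num_blocks:
  fixes b :: "nat \<Rightarrow> nat" and k m n :: nat
  assumes k: "k \<ge> 3" and b1: "b 1 > 0" and n: "\<And>i. i \<in> {1..k - 2} \<Longrightarrow> n * b (i + 1) \<le> b i"
  shows "\<exists>F :: nat set set. hypergraph F \<and> card F = m
           \<and> ex_num F (Hvec k b) \<le> (k - 1) * ((m - 1) div (k + n) + 1)"
proof -
  define s where "s = k + n"
  define a where "a l = (if l < k then b l else 0)" for l
  (* No conflict between the two cases: s \<ge> k, where unshift vanishes. *)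
  define w where "w j = (if j = s then b k else unshift k a n j)" for j
  define B where "B x = {y. y div s = x div s}" for x :: nat
  define E where "E x = {prod_encode (set_encode J, j) | J j. J \<subseteq> B x \<and> x \<in> J \<and> j < w (card J)}" for x
  have s: "s > 0" using k by (simp add: s_def)
  have H: "is_Hvec k b (Hvec k b)" using k b1 by (intro is_Hvec_Hvec[of 1]) auto
  have B_eq: "B x = {x div s * s..<x div s * s + s}" for x
  proof (intro set_eqI iffI)
    fix y assume "y \<in> B x"
    then have "y div s = x div s" by (simp add: B_def)
    then show "y \<in> {x div s * s..<x div s * s + s}"
      using s div_mult_mod_eq[of y s] mod_less_divisor[of s y]
      by (metis add_left_mono atLeastLessThan_iff le_add1 nat_add_left_cancel_less)
  next
    fix y assume "y \<in> {x div s * s..<x div s * s + s}"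
    then show "y \<in> B x" using s unfolding B_def by (auto intro!: div_nat_eqI simp: mult.commute)
  qed
  have finB: "finite (B x)" and cB: "card (B x) = s" for x by (simp_all add: B_eq)
  have Bself: "x \<in> B x" for x by (simp add: B_def)
  have Bcong: "B y = B x" if "y \<in> B x" for x y using that by (simp add: B_def)
  have finJ: "finite J" if "J \<subseteq> B x" for J x using that finB finite_subset by blast
  have mem: "prod_encode (set_encode J, j) \<in> E y \<longleftrightarrow> y \<in> J \<and> j < w (card J)"
    if J: "J \<subseteq> B x" and y: "y \<in> J \<or> y \<in> B x" for J j x y
  proof
    assume "prod_encode (set_encode J, j) \<in> E y"
    then obtain J' j' where *: "prod_encode (set_encode J, j) = prod_encode (set_encode J', j')"
      "J' \<subseteq> B y" "y \<in> J'" "j' < w (card J')" unfolding E_def by blast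
    have "set_encode J = set_encode J'" "j = j'" using *(1) by (simp_all add: prod_encode_eq)
    then have "J = J'" "j = j'" using finJ[OF J] finJ[OF *(2)] by (simp_all add: set_encode_eq)
    then show "y \<in> J \<and> j < w (card J)" using * by simp
  next
    assume a: "y \<in> J \<and> j < w (card J)"
    then have "B y = B x" using J Bcong by blast
    then show "prod_encode (set_encode J, j) \<in> E y" unfolding E_def using a J by blast
  qed
  have E_elt: "\<exists>J j. v = prod_encode (set_encode J, j) \<and> J \<subseteq> B x \<and> x \<in> J \<and> j < w (card J)"
    if "v \<in> E x" for v x
    using that unfolding E_def by blast
  have finE: "finite (E x)" for x
  proof (rule finite_subset)
    show "E x \<subseteq> (\<lambda>(J, j). prod_encode (set_encode J, j)) ` (SIGMA J:Pow (B x). {..<w (card J)})"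
      unfolding E_def by (force simp: image_iff)
    show "finite \<dots>" using finB by auto
  qed
  have a0: "a l = 0" if "l \<ge> k" for l using that by (simp add: a_def)
  have an: "n * a (l + 1) \<le> a l" if "l \<ge> 1" for l
    using n[of l] that k by (cases "l \<le> k - 2") (auto simp: a_def)
  (* The points of the cell of I within K, sorted by the set J of the other edges of the block
     that contain them. *)
  have w_sum: "(\<Sum>J\<in>Pow (B x - K). w (card (I \<union> J))) = b (card I)"
    if K: "K \<subseteq> B x" "card K = k" and I: "I \<subseteq> K" "I \<noteq> {}" for x K I
  proof -
    let ?N = "B x - K"
    have fin: "finite K" "finite I" "finite ?N"
      using finJ[OF K(1)] finite_subset[OF I(1)] finB by simp_all
    have cN: "card ?N = n" using card_Diff_subset[OF fin(1) K(1)] K(2) cB by (simp add: s_def)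
    have cIJ: "card (I \<union> J) = card I + card J" "finite J" if "J \<in> Pow ?N" for J
    proof -
      show "finite J" using that fin(3) finite_subset by blast
      then show "card (I \<union> J) = card I + card J"
        using that I(1) fin(2) by (intro card_Un_disjoint) auto
    qed
    have cI: "card I \<ge> 1" using I fin by (simp add: Suc_le_eq card_gt_0_iff)
    show ?thesis
    proof (cases "I = K")
      case False
      then have less: "card I < k" using I(1) K(2) fin(1) psubset_card_mono by blast
      have "w (card (I \<union> J)) = unshift k a n (card I + card J)" if J: "J \<in> Pow ?N" for J
      proof -
        have "card J \<le> n" using J cN card_mono[OF fin(3)] by auto
        then show ?thesis using less cIJ[OF J] by (simp add: w_def s_def)
      qed
      then have "(\<Sum>J\<in>Pow ?N. w (card (I \<union> J))) = (\<Sum>J\<in>Pow ?N. unshift k a n (card I + card J))"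
        by (intro sum.cong) auto
      also have "\<dots> = a (card I)"
        using sum_unshift_Pow[OF fin(3) cI a0, of k] an cN by simp
      finally show ?thesis using less by (simp add: a_def)
    next
      case True
      have "w (card (I \<union> J)) = (if J = ?N then b k else 0)" if J: "J \<in> Pow ?N" for J
      proof (cases "J = ?N")
        case False
        then have "card J < n" using J cN psubset_card_mono[OF fin(3), of J] by auto
        moreover have "unshift k a n (k + card J) = 0"
          using unshift_le[of k a n "k + card J"] a0 by simp
        ultimately show ?thesis using False True K(2) cIJ[OF J] by (simp add: w_def s_def)
      next
        case T: True
        then have "card (I \<union> J) = s" using cIJ(1)[OF J] True K(2) cN by (simp add: s_def)
        then show ?thesis using T by (simp add: w_def)
      qed
      then have "(\<Sum>J\<in>Pow ?N. w (card (I \<union> J))) = (\<Sum>J\<in>Pow ?N. if J = ?N then b k else 0)"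
        by (intro sum.cong) auto
      also have "\<dots> = b k" using fin(3) by simp
      finally show ?thesis using True K(2) by simp
    qed
  qed
  have cell: "card ((\<Inter>y\<in>I. E y) - (\<Union>y\<in>K - I. E y)) = b (card I)"
    if K: "K \<subseteq> B x" "card K = k" and I: "I \<subseteq> K" "I \<noteq> {}" for x K I
  proof -
    let ?S = "SIGMA J:Pow (B x - K). {..<w (card (I \<union> J))}"
    let ?f = "\<lambda>(J, j). prod_encode (set_encode (I \<union> J), j)"
    have "(\<Inter>y\<in>I. E y) - (\<Union>y\<in>K - I. E y) = ?f ` ?S"
    proof (intro equalityI subsetI)
      fix v assume v: "v \<in> (\<Inter>y\<in>I. E y) - (\<Union>y\<in>K - I. E y)"
      obtain y0 where y0: "y0 \<in> I" using I by blast
      then have "v \<in> E y0" using v by blast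
      moreover have "B y0 = B x" using y0 I K Bcong by blast
      ultimately obtain J j where J: "v = prod_encode (set_encode J, j)" "J \<subseteq> B x" "j < w (card J)"
        using E_elt by metis
      have memv: "v \<in> E y \<longleftrightarrow> y \<in> J" if "y \<in> K" for y
        using mem[OF J(2), of y j] J that K by auto
      have "J \<inter> K = I" using v memv I by blast
      then have "J = I \<union> (J - K)" by blast
      moreover have "J - K \<in> Pow (B x - K)" using J by blast
      ultimately show "v \<in> ?f ` ?S" using J by (intro image_eqI[of _ _ "(J - K, j)"]) auto
    next
      fix v assume "v \<in> ?f ` ?S"
      then obtain J j where J: "v = prod_encode (set_encode (I \<union> J), j)" "J \<subseteq> B x - K"
        "j < w (card (I \<union> J))" by auto
      have "I \<union> J \<subseteq> B x" using J K I by blast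
      then have "v \<in> E y \<longleftrightarrow> y \<in> I \<union> J" if "y \<in> K" for y
        using mem[of "I \<union> J" x y j] J that K by auto
      then show "v \<in> (\<Inter>y\<in>I. E y) - (\<Union>y\<in>K - I. E y)" using J I by blast
    qed
    moreover have "inj_on ?f ?S"
    proof (rule inj_onI)
      fix p q assume pq: "p \<in> ?S" "q \<in> ?S" "?f p = ?f q"
      obtain J j J' j' where e: "p = (J, j)" "q = (J', j')" by fastforce
      have "I \<subseteq> B x" using I K by blast
      then have "finite (I \<union> J)" "finite (I \<union> J')" using pq e finJ[of _ x] by auto
      then have "I \<union> J = I \<union> J'" "j = j'" using pq(3) e by (auto simp: prod_encode_eq set_encode_eq)
      moreover have "J \<inter> I = {}" "J' \<inter> I = {}" using pq e I by auto
      ultimately show "p = q" using e by blast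
    qed
    ultimately have "card ((\<Inter>y\<in>I. E y) - (\<Union>y\<in>K - I. E y)) = card ?S" by (simp add: card_image)
    also have "\<dots> = (\<Sum>J\<in>Pow (B x - K). w (card (I \<union> J)))" using finB by (subst card_SigmaI) auto
    also have "\<dots> = b (card I)" by (rule w_sum[OF K I])
    finally show ?thesis .
  qed
  (* Enlarge the part of {x, y} in the block of x to a set K of k indices. As b 1 > 0, some
     vertex of E x lies in no other edge of K, and it cannot lie in E y either. *)
  have injE: "inj E"
  proof (rule injI, rule ccontr)
    fix x y assume xy: "E x = E y" "x \<noteq> y"
    have "card ({x, y} \<inter> B x) \<le> 2" using card_mono[of "{x, y}" "{x, y} \<inter> B x"] xy by simp
    then have "card ({x, y} \<inter> B x) \<le> k" "k \<le> card (B x)" using k cB by (auto simp: s_def)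
    then obtain K where K: "{x, y} \<inter> B x \<subseteq> K" "K \<subseteq> B x" "card K = k"
      using exists_subset_between[of "{x, y} \<inter> B x" k "B x"] finB by auto
    have xK: "x \<in> K" using K Bself by blast
    then have "card ((\<Inter>z\<in>{x}. E z) - (\<Union>z\<in>K - {x}. E z)) > 0"
      using cell[OF K(2,3), of "{x}"] b1 by simp
    then have "(\<Inter>z\<in>{x}. E z) - (\<Union>z\<in>K - {x}. E z) \<noteq> {}" by (metis card.empty less_irrefl)
    then obtain v where v: "v \<in> E x" "\<And>z. z \<in> K \<Longrightarrow> z \<noteq> x \<Longrightarrow> v \<notin> E z" by blast
    obtain J j where J: "v = prod_encode (set_encode J, j)" "J \<subseteq> B x" "x \<in> J" "j < w (card J)"
      using E_elt[OF v(1)] by blast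
    obtain J' j' where J': "v = prod_encode (set_encode J', j')" "J' \<subseteq> B y" "y \<in> J'"
      using E_elt[of v y] v(1) xy(1) by blast
    have "set_encode J = set_encode J'" using J(1) J'(1) by (simp add: prod_encode_eq)
    then have "J = J'" using finJ[OF J(2)] finJ[OF J'(2)] by (simp add: set_encode_eq)
    then have "y \<in> K" using J J' K by blast
    then show False using v xy by auto
  qed
  have copy: "is_Hvec k b (E ` K)" if K: "K \<subseteq> B x" "card K = k" for x K
    unfolding is_Hvec_iff_cells
  proof (intro conjI allI impI)
    have inj: "inj_on E L" for L using injE by (rule inj_on_subset) simp
    show "finite (E ` K)" using K finJ by blast
    show "card (E ` K) = k" using K(2) inj by (simp add: card_image)
    show "\<forall>e\<in>E ` K. finite e" using finE by blast
    fix D assume D: "D \<subseteq> E ` K" "D \<noteq> {}"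
    then obtain I where I: "I \<subseteq> K" "D = E ` I" by (auto simp: subset_image_iff)
    have "E ` K - D = E ` (K - I)" using I injE by (simp add: image_set_diff)
    moreover have "card D = card I" using I inj by (simp add: card_image)
    ultimately show "card (\<Inter>D - \<Union>(E ` K - D)) = b (card D)" using cell[OF K I(1)] I D by simp
  qed
  define F where "F = E ` {..<m}"
  have finF: "finite F" by (simp add: F_def)
  have "hypergraph F" using finE by (auto simp: hypergraph_def F_def)
  moreover have "card F = m"
    unfolding F_def using inj_on_subset[OF injE] by (simp add: card_image)
  moreover have "ex_num F (Hvec k b) \<le> (k - 1) * ((m - 1) div s + 1)"
  proof (rule ex_num_le[OF finF])
    show "hg_free (Hvec k b) {}"
      unfolding hg_free_Hvec_iff[OF H] using k by (auto simp: is_Hvec_iff_cells)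
    fix G assume G: "G \<subseteq> F" "hg_free (Hvec k b) G"
    then obtain Y where Y: "Y \<subseteq> {..<m}" "G = E ` Y" unfolding F_def by (auto simp: subset_image_iff)
    have finY: "finite Y" using Y(1) finite_subset by blast
    have "card {y\<in>Y. y div s = q} \<le> k - 1" for q
    proof (rule ccontr)
      assume "\<not> ?thesis"
      then have "k \<le> card {y\<in>Y. y div s = q}" by simp
      then obtain K where K: "K \<subseteq> {y\<in>Y. y div s = q}" "card K = k"
        by (meson obtain_subset_with_card_n)
      then obtain x where "x \<in> K" using k by fastforce
      then have "K \<subseteq> B x" using K by (auto simp: B_def)
      then have "is_Hvec k b (E ` K)" using copy K by blast
      moreover have "E ` K \<subseteq> G" using K Y by blast
      ultimately show False using G(2) by (simp add: hg_free_Hvec_iff[OF H])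
    qed
    moreover have "Y = (\<Union>q\<in>{..(m - 1) div s}. {y\<in>Y. y div s = q})"
    proof -
      have "y div s \<le> (m - 1) div s" if "y \<in> Y" for y
        using that Y(1) by (intro div_le_mono) auto
      then show ?thesis by blast
    qed
    then have "card Y \<le> (\<Sum>q\<in>{..(m - 1) div s}. card {y\<in>Y. y div s = q})"
      using card_UN_le[of "{..(m - 1) div s}" "\<lambda>q. {y\<in>Y. y div s = q}"] by simp
    ultimately have "card Y \<le> (\<Sum>q\<in>{..(m - 1) div s}. k - 1)" by (meson order_trans sum_mono)
    moreover have "card G = card Y"
      unfolding Y(2) using inj_on_subset[OF injE] by (simp add: card_image)
    ultimately show "card G \<le> (k - 1) * ((m - 1) div s + 1)" by (simp add: mult.commute)
  qed
  ultimately show ?thesis unfolding s_def by blast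
qed

section \<open>The two bounds in terms of \<open>\<alpha>\<close>\<close>

text \<open>The value \<open>\<infinity>\<close> occurs only when all denominators vanish; otherwise \<open>\<alpha>\<close> is attained at an
  index \<open>i\<close> with \<open>b\<^bsub>i+1\<^esub> > 0\<close>. In the last clause the inequality is cleared of denominators, so
  that it also covers the indices with quotient \<open>\<infinity>\<close>.\<close>

lemma alpha_cases:
  assumes k: "k \<ge> 3" and m: "m \<ge> 1" and pos: "\<forall>i\<in>{1..k - 2}. b m i > 0"
  obtains (top) "alpha k b m = \<infinity>" "\<And>i. i \<in> {1..k - 2} \<Longrightarrow> b m (i + 1) = 0"
  | (real) r i where "alpha k b m = ereal r" "r > 0" "i \<in> {1..k - 2}" "b m (i + 1) > 0"
      "real m * r = real (b m i) / real (b m (i + 1))"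
      "\<And>j. j \<in> {1..k - 2} \<Longrightarrow> real m * r * real (b m (j + 1)) \<le> real (b m j)"
proof -
  let ?q = "\<lambda>i. ereal (real (b m i)) / ereal (real m * real (b m (i + 1)))"
  have q_inf: "?q i = \<infinity>" if "i \<in> {1..k - 2}" "b m (i + 1) = 0" for i
    using bspec[OF pos that(1)] that(2) by (simp add: divide_ereal_def)
  have q_real: "?q i = ereal (real (b m i) / (real m * real (b m (i + 1))))"
    if "b m (i + 1) > 0" for i
    using that m by simp
  have "1 \<in> {1..k - 2}" using k by simp
  then have ne: "?q ` {1..k - 2} \<noteq> {}" by blast
  have "alpha k b m \<in> ?q ` {1..k - 2}" unfolding alpha_def using ne by (intro Min_in) auto
  then obtain i where i: "i \<in> {1..k - 2}" "alpha k b m = ?q i" by blast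
  have le: "alpha k b m \<le> ?q j" if "j \<in> {1..k - 2}" for j
    unfolding alpha_def using that by (intro Min_le) auto
  show thesis
  proof (cases "b m (i + 1) = 0")
    case True
    then have a: "alpha k b m = \<infinity>" using i q_inf by simp
    have "b m (j + 1) = 0" if "j \<in> {1..k - 2}" for j
      using le[OF that] q_real[of j] a by (cases "b m (j + 1) = 0") auto
    then show thesis using a top by blast
  next
    case False
    then have c: "b m (i + 1) > 0" by simp
    define r where "r = real (b m i) / (real m * real (b m (i + 1)))"
    have a: "alpha k b m = ereal r" using i q_real[OF c] by (simp add: r_def)
    have "r > 0" using bspec[OF pos i(1)] c m by (simp add: r_def)
    moreover have "real m * r = real (b m i) / real (b m (i + 1))" using m by (simp add: r_def)
    moreover have "real m * r * real (b m (j + 1)) \<le> real (b m j)" if j: "j \<in> {1..k - 2}" for j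
    proof (cases "b m (j + 1) = 0")
      case False
      then have "r \<le> real (b m j) / (real m * real (b m (j + 1)))"
        using le[OF j] q_real[of j] a by simp
      then show ?thesis using False m by (simp add: field_simps)
    qed simp
    ultimately show thesis using real[OF a _ i(1) c] by blast
  qed
qed

lemma f_num_lower:
  assumes k: "k \<ge> 3" and m: "m \<ge> 1" and pos: "\<forall>i\<in>{1..k - 2}. b m i > 0"
  shows "ereal (real_of_ereal
        (1 / (2 * (alpha k b m + ereal (1 / real m))
               * ereal (real ((b m (k - 1) + b m k) choose b m k)))) powr (1 / real k))
      \<le> ereal (real (f_num m (Hvec k (b m))))"
using k m pos
proof (cases rule: alpha_cases)
  case top
  have "(b m (k - 1) + b m k) choose b m k > 0" by simp
  then show ?thesis using top by simp
next
  case (real r i)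
  define c where "c = (b m (k - 1) + b m k) choose b m k"
  define f where "f = f_num m (Hvec k (b m))"
  have c: "c > 0" by (simp add: c_def)
  have H: "is_Hvec k (b m) (Hvec k (b m))" using k bspec[OF pos, of 1] by (intro is_Hvec_Hvec[of 1]) auto
  obtain F :: "nat set set" where F: "hypergraph F" "card F = m" "ex_num F (Hvec k (b m)) = f"
    using f_num_attained unfolding f_def by blast
  have "m * b m (i + 1) \<le> 2 * (b m i + b m (i + 1)) * c * f ^ k"
    using card_le_ex_num_power[OF _ real(3) H, of F] F by (simp add: c_def hypergraph_def)
  then have "real m * real (b m (i + 1)) \<le> 2 * (real (b m i) + real (b m (i + 1))) * real c * real f ^ k"
    by (metis (mono_tags) of_nat_le_iff of_nat_mult of_nat_add of_nat_numeral of_nat_power)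
  moreover have "real (b m i) = real m * r * real (b m (i + 1))"
    using real(4,5) by (simp add: field_simps)
  ultimately have "real (b m (i + 1)) * real m
      \<le> real (b m (i + 1)) * (2 * (real m * r + 1) * real c * real f ^ k)"
    by (simp add: algebra_simps)
  then have "real m \<le> 2 * (real m * r + 1) * real c * real f ^ k"
    using real(4) by (subst (asm) mult_le_cancel_left_pos) auto
  then have *: "1 / (2 * (r + 1 / real m) * real c) \<le> real f ^ k"
    using m c real(2) by (simp add: field_simps add_pos_pos)
  have "(1 / (2 * (r + 1 / real m) * real c)) powr (1 / real k) \<le> (real f ^ k) powr (1 / real k)"
    using * real(2) m c by (intro powr_mono2) auto
  also have "\<dots> = real f" using k by (cases "f = 0") (auto simp: powr_realpow[symmetric] powr_powr)
  finally have "(1 / (2 * (r + 1 / real m) * real c)) powr (1 / real k) \<le> real f" .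
  moreover have "2 * (r + 1 / real m) * real c \<noteq> 0" using real(2) c by (simp add: add_pos_nonneg less_imp_neq[symmetric])
  ultimately show ?thesis
    unfolding c_def[symmetric] f_def[symmetric] real(1)
    by (simp add: one_ereal_def numeral_eq_ereal)
qed

lemma f_num_upper:
  assumes k: "k \<ge> 3" and m: "m \<ge> 1" and pos: "\<forall>i\<in>{1..k - 2}. b m i > 0"
  shows "ereal (real (f_num m (Hvec k (b m))))
      \<le> ereal (real (k * (k - 1))) / alpha k b m + ereal (real (k - 1))"
proof -
  have bound: "f_num m (Hvec k (b m)) \<le> (k - 1) * ((m - 1) div (k + n) + 1)"
    if "\<And>i. i \<in> {1..k - 2} \<Longrightarrow> n * b m (i + 1) \<le> b m i" for n
  proof -
    have "b m 1 > 0" using bspec[OF pos, of 1] k by simp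
    from ex_num_blocks[OF k this that, of m]
    show ?thesis using f_num_le_ex_num order_trans by blast
  qed
  show ?thesis
  using k m pos
proof (cases rule: alpha_cases)
    case top
    (* Here n is unrestricted; with n = m a single block accommodates all m edges. *)
    have "f_num m (Hvec k (b m)) \<le> (k - 1) * ((m - 1) div (k + m) + 1)"
      using top by (intro bound) simp
    moreover have "(m - 1) div (k + m) = 0" using k by simp
    ultimately have "f_num m (Hvec k (b m)) \<le> k - 1" by (simp only: add_0 mult_1_right)
    then show ?thesis using top by simp
  next
    case (real r i)
    define n where "n = nat \<lfloor>real m * r\<rfloor>"
    have n: "real n \<le> real m * r" "real m * r \<le> real (k + n)"
      unfolding n_def using real(2) k by (simp_all, linarith)
    have "n * b m (j + 1) \<le> b m j" if "j \<in> {1..k - 2}" for j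
    proof -
      have "real n * real (b m (j + 1)) \<le> real m * r * real (b m (j + 1))"
        using n by (intro mult_right_mono) auto
      also have "\<dots> \<le> real (b m j)" by (rule real(6)[OF that])
      finally show ?thesis by (metis of_nat_le_iff of_nat_mult)
    qed
    from bound[OF this]
    have "real (f_num m (Hvec k (b m))) \<le> real ((k - 1) * ((m - 1) div (k + n) + 1))"
      by (simp only: of_nat_le_iff)
    also have "\<dots> = real (k - 1) * real ((m - 1) div (k + n)) + real (k - 1)"
      by (simp only: of_nat_mult of_nat_add of_nat_1 distrib_left mult_1_right)
    also have "\<dots> \<le> real (k - 1) * (real k / r) + real (k - 1)"
    proof (intro add_right_mono mult_left_mono)
      have "real ((m - 1) div (k + n)) \<le> real (m - 1) / real (k + n)"
        by (rule of_nat_div_le_of_nat)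
      also have "\<dots> \<le> real m / (real m * r)"
        using n real(2) m by (intro frac_le) auto
      also have "\<dots> \<le> real k / r" using m k real(2) by (simp add: divide_right_mono)
      finally show "real ((m - 1) div (k + n)) \<le> real k / r" .
    qed simp
    finally show ?thesis using real(1,2) by (simp add: mult_ac)
  qed
qed

theorem theorem2p7:
  fixes k :: nat and b :: "nat \<Rightarrow> nat \<Rightarrow> nat"
  assumes "k \<ge> 3"
    and "\<And>m i. m \<ge> 1 \<Longrightarrow> i \<in> {1..k - 2} \<Longrightarrow> b m i > 0"
  shows "\<forall>m\<ge>6.
    ereal (real_of_ereal
        (1 / (2 * (alpha k b m + ereal (1 / real m))
               * ereal (real ((b m (k - 1) + b m k) choose b m k)))) powr (1 / real k))
      \<le> ereal (real (f_num m (Hvec k (b m))))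
    \<and> ereal (real (f_num m (Hvec k (b m))))
      \<le> ereal (real (k * (k - 1))) / alpha k b m + ereal (real (k - 1))"
  using f_num_lower[OF assms(1)] f_num_upper[OF assms(1)] assms(2) by simp

end
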